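(* Let $X$ be a set, let $\mathcal{Y}$ be an inner product space, and let $\mathcal{H}$ be a $\mathcal{Y}$-valued relative reproducing kernel Hilbert space on $X$, i.e. a $\mathcal{Y}$-valued reproducing kernel Hilbert space $\mathcal{H}$ of functions from $X$ to $\mathcal{Y}$ for which there exists a family $(M_{x,y})_{x,y\in X}$ such that $M_{x,y}\in\mathcal{L}(\mathcal{Y},\mathcal{H})$ for all $x,y\in X$, and $$f(y)-f(x)=M_{x,y}^{*}f\qquad\text{for all } x,y\in X,\ f\in\mathcal{H}.$$ Then the family $(M_{x,y})_{x,y\in X}$ with these properties is unique, and it satisfies $$M_{x_1,x_2}(t)+M_{x_2,x_3}(t)=M_{x_1,x_3}(t)\qquad\text{for all } x_1,x_2,x_3\in X,\ t\in\mathcal{Y}.$$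
   Context: All spaces are over the same scalar field ($\mathbb{R}$ or $\mathbb{C}$). $\mathcal{L}(\mathcal{Y},\mathcal{H})$ denotes the bounded linear operators from $\mathcal{Y}$ to $\mathcal{H}$, $\mathcal{L}(\mathcal{Y})=\mathcal{L}(\mathcal{Y},\mathcal{Y})$, and $\mathcal{F}(X,\mathcal{Y})$ denotes the vector space of all functions $X\to\mathcal{Y}$. For $T\in\mathcal{L}(\mathcal{Y},\mathcal{H})$, the adjoint $T^{*}:\mathcal{H}\to\mathcal{Y}$ is the linear map with $\langle Ty,f\rangle_{\mathcal{H}}=\langle y,T^{*}f\rangle_{\mathcal{Y}}$ for all $y\in\mathcal{Y}$, $f\in\mathcal{H}$; the existence of this adjoint is part of the hypothesis whenever $T^{*}$ is written (it is automatic if $\mathcal{Y}$ is complete). A $\mathcal{Y}$-reproducing kernel is a map $K:X\times X\to\mathcal{L}(\mathcal{Y})$ such that $\sum_{i,j=1}^{n}\langle K(x_i,x_j)y_j,y_i\rangle\ge 0$ for all $n\ge 1$, $x_1,\dots,x_n\in X$, $y_1,\dots,y_n\in\mathcal{Y}$. For $x\in X$, $K_x:\mathcal{Y}\to\mathcal{F}(X,\mathcal{Y})$ is the linear operator $(K_x y)(t)=K(t,x)y$, $t\in X$. A Hilbert space $\mathcal{H}\subset\mathcal{F}(X,\mathcal{Y})$ is a $\mathcal{Y}$-valued reproducing kernel Hilbert space with reproducing kernel $K$ if $K_x\in\mathcal{L}(\mathcal{Y},\mathcal{H})$ for all $x\in X$ and $f(x)=K_x^{*}f$ for all $x\in X$,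 $f\in\mathcal{H}$. *)

theory Defs
  imports Complex_Main "HOL-Library.Function_Algebras" "HOL-Library.Nonpos_Ints"
begin

(* The scalar fields R and C.  The axioms admit no others: z is a root of the real quadratic
   polynomial (t - z) (t - conj z), see lemma real_or_complex below. *)
class real_or_complex = real_normed_field +
  fixes conj :: "'a \<Rightarrow> 'a"
  assumes conj_add: "conj (x + y) = conj x + conj y"
    and conj_mult: "conj (x * y) = conj x * conj y"
    and conj_scaleR_one: "conj (r *\<^sub>R 1) = r *\<^sub>R 1"
    and mult_conj: "x * conj x = (norm x)\<^sup>2 *\<^sub>R 1"

instantiation real :: real_or_complex
begin
definition conj_real :: "real \<Rightarrow> real" where "conj_real x = x"
instance by standard (simp_all add: conj_real_def power2_eq_square)
end

instantiation complex :: real_or_complex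
begin
definition conj_complex :: "complex \<Rightarrow> complex" where "conj_complex = cnj"
instance by standard (simp_all add: conj_complex_def complex_norm_square[symmetric] scaleR_conv_of_real del: of_real_power)
end

lemma nonreal_scalar:
  fixes z :: "'k :: real_or_complex"
  assumes "z \<notin> \<real>"
  obtains a b :: real and i :: 'k where "i * i = -1" "z = of_real a + of_real b * i"
proof -
  define p where "p = (norm (z + 1))\<^sup>2 - (norm z)\<^sup>2 - 1"
  define q where "q = (norm z)\<^sup>2"
  have "(z + 1) * conj (z + 1) = of_real ((norm (z + 1))\<^sup>2)"
    by (simp only: mult_conj of_real_def)
  moreover have "conj (1 :: 'k) = 1" using conj_scaleR_one[of 1, where 'a = 'k] by simp
  ultimately have p: "z + conj z = of_real p"
    using mult_conj[of z] by (simp add: p_def conj_add algebra_simps of_real_def)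
  have q: "z * conj z = of_real q" by (simp only: q_def mult_conj of_real_def)
  define w where "w = z - of_real (p / 2)"
  define d where "d = q - (p / 2)\<^sup>2"
  have c: "conj z = of_real p - z" using p by (simp add: algebra_simps)
  have "z * (of_real p - z) = of_real q" using q unfolding c .
  moreover have "of_real p = 2 * (of_real (p / 2) :: 'k)" by simp
  ultimately have w: "w * w = of_real (- d)"
    unfolding w_def d_def of_real_minus of_real_diff of_real_power
    by (simp only: power2_eq_square) (simp add: algebra_simps del: of_real_divide)
  have d: "d > 0"
  proof (rule ccontr)
    assume "\<not> d > 0"
    then have "w * w = of_real (sqrt (- d)) * of_real (sqrt (- d))"
      using w by (simp flip: of_real_mult)
    then have "w = of_real (sqrt (- d)) \<or> w = - of_real (sqrt (- d))"
      by (simp add: square_eq_iff)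
    then have "w \<in> \<real>" by auto
    then have "w + of_real (p / 2) \<in> \<real>" by (intro Reals_add Reals_of_real)
    then show False using assms by (simp add: w_def)
  qed
  define i where "i = w / of_real (sqrt d)"
  have "i * i = (w * w) / of_real (sqrt d * sqrt d)"
    unfolding i_def of_real_mult by simp
  also have "\<dots> = -1" using d by (simp add: w)
  finally have "i * i = -1" .
  moreover have "z = of_real (p / 2) + of_real (sqrt d) * i"
    using d by (simp add: i_def w_def)
  ultimately show ?thesis by (rule that)
qed

lemma real_or_complex:
  "(UNIV :: 'k :: real_or_complex set) = \<real> \<or>
   (\<exists>i :: 'k. i * i = -1 \<and> (\<forall>z. \<exists>a b. z = of_real a + of_real b * i))"
proof (cases "(UNIV :: 'k set) = \<real>")
  case False
  then obtain z0 :: 'k where "z0 \<notin> \<real>" by auto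
  then obtain i :: 'k where i: "i * i = -1" by (rule nonreal_scalar)
  have "\<exists>a b. z = of_real a + of_real b * i" for z
  proof (cases "z \<in> \<real>")
    case True
    then obtain r where "z = of_real r + of_real 0 * i" by (auto elim: Reals_cases)
    then show ?thesis by blast
  next
    case False
    then obtain a b and j :: 'k where j: "j * j = -1" "z = of_real a + of_real b * j"
      by (rule nonreal_scalar)
    then have "j * j = i * i" using i by simp
    then have "j = i \<or> j = - i" by (simp add: square_eq_iff)
    then have "z = of_real a + of_real b * i \<or> z = of_real a + of_real (- b) * i"
      using j by auto
    then show ?thesis by blast
  qed
  then show ?thesis using i by blast
qed simp

(* A space is a linear subspace car of an ambient vector space whose vectors form a type,
   with an inner product that is only meaningful on car. *)
record ('k, 'v) ip_space =
  car :: "'v set"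
  scl :: "'k \<Rightarrow> 'v \<Rightarrow> 'v"
  ip :: "'v \<Rightarrow> 'v \<Rightarrow> 'k"

locale inner_product_space =
  fixes V :: "('k :: real_or_complex, 'v :: ab_group_add) ip_space"
  assumes vector_space: "vector_space (scl V)"
    and subspace: "module.subspace (scl V) (car V)"
    and ip_add_left: "\<lbrakk>u \<in> car V; v \<in> car V; w \<in> car V\<rbrakk> \<Longrightarrow> ip V (u + v) w = ip V u w + ip V v w"
    and ip_scale_left: "\<lbrakk>u \<in> car V; v \<in> car V\<rbrakk> \<Longrightarrow> ip V (scl V c u) v = c * ip V u v"
    and ip_conj: "\<lbrakk>u \<in> car V; v \<in> car V\<rbrakk> \<Longrightarrow> ip V v u = conj (ip V u v)"
    and ip_nonneg: "u \<in> car V \<Longrightarrow> ip V u u \<in> \<real>\<^sub>\<ge>\<^sub>0"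
    and ip_definite: "\<lbrakk>u \<in> car V; ip V u u = 0\<rbrakk> \<Longrightarrow> u = 0"

definition ip_norm :: "('k :: real_or_complex, 'v :: ab_group_add) ip_space \<Rightarrow> 'v \<Rightarrow> real" where
  "ip_norm V v = sqrt (norm (ip V v v))"

locale hilbert_space = inner_product_space +
  assumes complete:
    "\<lbrakk>\<And>n. s n \<in> car V;
      \<And>e. e > 0 \<Longrightarrow> \<exists>N. \<forall>m\<ge>N. \<forall>n\<ge>N. ip_norm V (s m - s n) < e\<rbrakk>
     \<Longrightarrow> \<exists>l\<in>car V. (\<lambda>n. ip_norm V (s n - l)) \<longlonglongrightarrow> 0"

definition linear_map ::
  "('k :: real_or_complex, 'v :: ab_group_add) ip_space \<Rightarrow> ('k, 'w :: ab_group_add) ip_space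
   \<Rightarrow> ('v \<Rightarrow> 'w) \<Rightarrow> bool" where
  "linear_map V W T \<longleftrightarrow>
     (\<forall>v\<in>car V. T v \<in> car W) \<and>
     (\<forall>u\<in>car V. \<forall>v\<in>car V. T (u + v) = T u + T v) \<and>
     (\<forall>c. \<forall>v\<in>car V. T (scl V c v) = scl W c (T v))"

definition bounded_ops ::
  "('k :: real_or_complex, 'v :: ab_group_add) ip_space \<Rightarrow> ('k, 'w :: ab_group_add) ip_space
   \<Rightarrow> ('v \<Rightarrow> 'w) set" where
  "bounded_ops V W =
     {T. linear_map V W T \<and> (\<exists>B. \<forall>v\<in>car V. ip_norm W (T v) \<le> B * ip_norm V v)}"

definition is_adjoint ::
  "('k :: real_or_complex, 'v :: ab_group_add) ip_space \<Rightarrow> ('k, 'w :: ab_group_add) ip_space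
   \<Rightarrow> ('v \<Rightarrow> 'w) \<Rightarrow> ('w \<Rightarrow> 'v) \<Rightarrow> bool" where
  "is_adjoint V W T S \<longleftrightarrow>
     linear_map W V S \<and> (\<forall>v\<in>car V. \<forall>w\<in>car W. ip W (T v) w = ip V v (S w))"

definition adjointable ::
  "('k :: real_or_complex, 'v :: ab_group_add) ip_space \<Rightarrow> ('k, 'w :: ab_group_add) ip_space
   \<Rightarrow> ('v \<Rightarrow> 'w) \<Rightarrow> bool" where
  "adjointable V W T \<longleftrightarrow> (\<exists>S. is_adjoint V W T S)"

(* Determined on car W when T is adjointable, arbitrary otherwise. *)
definition adj ::
  "('k :: real_or_complex, 'v :: ab_group_add) ip_space \<Rightarrow> ('k, 'w :: ab_group_add) ip_space
   \<Rightarrow> ('v \<Rightarrow> 'w) \<Rightarrow> 'w \<Rightarrow> 'v" where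
  "adj V W T = (SOME S. is_adjoint V W T S)"

(* A function X \<rightarrow> Y is represented by its extension by 0 to the whole type of X, so that the
   pointwise operations on the function type are those of the vector space of functions. *)
definition function_space :: "'x set \<Rightarrow> ('k, 'y :: ab_group_add) ip_space \<Rightarrow> ('x \<Rightarrow> 'y) set" where
  "function_space X Y = {f. (\<forall>t\<in>X. f t \<in> car Y) \<and> (\<forall>t. t \<notin> X \<longrightarrow> f t = 0)}"

definition hilbert_function_space ::
  "'x set \<Rightarrow> ('k :: real_or_complex, 'y :: ab_group_add) ip_space
   \<Rightarrow> ('k, 'x \<Rightarrow> 'y) ip_space \<Rightarrow> bool" where
  "hilbert_function_space X Y H \<longleftrightarrow>
     hilbert_space H \<and> car H \<subseteq> function_space X Y \<and> scl H = (\<lambda>c f t. scl Y c (f t))"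

definition reproducing_kernel ::
  "'x set \<Rightarrow> ('k :: real_or_complex, 'y :: ab_group_add) ip_space
   \<Rightarrow> ('x \<Rightarrow> 'x \<Rightarrow> 'y \<Rightarrow> 'y) \<Rightarrow> bool" where
  "reproducing_kernel X Y K \<longleftrightarrow>
     (\<forall>s\<in>X. \<forall>t\<in>X. K s t \<in> bounded_ops Y Y) \<and>
     (\<forall>n\<ge>1::nat. \<forall>x y. (\<forall>i<n. x i \<in> X \<and> y i \<in> car Y) \<longrightarrow>
        (\<Sum>i<n. \<Sum>j<n. ip Y (K (x i) (x j) (y j)) (y i)) \<in> \<real>\<^sub>\<ge>\<^sub>0)"

definition kernel_section ::
  "'x set \<Rightarrow> ('x \<Rightarrow> 'x \<Rightarrow> 'y \<Rightarrow> 'y :: zero) \<Rightarrow> 'x \<Rightarrow> 'y \<Rightarrow> 'x \<Rightarrow> 'y" where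
  "kernel_section X K x y = (\<lambda>t. if t \<in> X then K t x y else 0)"

definition rkhs_with_kernel ::
  "'x set \<Rightarrow> ('k :: real_or_complex, 'y :: ab_group_add) ip_space
   \<Rightarrow> ('k, 'x \<Rightarrow> 'y) ip_space \<Rightarrow> ('x \<Rightarrow> 'x \<Rightarrow> 'y \<Rightarrow> 'y) \<Rightarrow> bool" where
  "rkhs_with_kernel X Y H K \<longleftrightarrow>
     hilbert_function_space X Y H \<and> reproducing_kernel X Y K \<and>
     (\<forall>x\<in>X. kernel_section X K x \<in> bounded_ops Y H \<and>
            adjointable Y H (kernel_section X K x) \<and>
            (\<forall>f\<in>car H. f x = adj Y H (kernel_section X K x) f))"

definition rkhs ::
  "'x set \<Rightarrow> ('k :: real_or_complex, 'y :: ab_group_add) ip_space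
   \<Rightarrow> ('k, 'x \<Rightarrow> 'y) ip_space \<Rightarrow> bool" where
  "rkhs X Y H \<longleftrightarrow> (\<exists>K. rkhs_with_kernel X Y H K)"

definition difference_family ::
  "'x set \<Rightarrow> ('k :: real_or_complex, 'y :: ab_group_add) ip_space
   \<Rightarrow> ('k, 'x \<Rightarrow> 'y) ip_space \<Rightarrow> ('x \<Rightarrow> 'x \<Rightarrow> 'y \<Rightarrow> 'x \<Rightarrow> 'y) \<Rightarrow> bool" where
  "difference_family X Y H M \<longleftrightarrow>
     (\<forall>x\<in>X. \<forall>y\<in>X. M x y \<in> bounded_ops Y H \<and> adjointable Y H (M x y) \<and>
        (\<forall>f\<in>car H. f y - f x = adj Y H (M x y) f))"

definition relative_rkhs ::
  "'x set \<Rightarrow> ('k :: real_or_complex, 'y :: ab_group_add) ip_space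
   \<Rightarrow> ('k, 'x \<Rightarrow> 'y) ip_space \<Rightarrow> bool" where
  "relative_rkhs X Y H \<longleftrightarrow> rkhs X Y H \<and> (\<exists>M. difference_family X Y H M)"

end

theory Submission
  imports Defs
begin

text \<open>The adjoint relation gives \<open>\<langle>M x y t, f\<rangle> = \<langle>t, f y - f x\<rangle>\<close> for every \<open>f\<close> in \<open>H\<close>, and
  an element of \<open>H\<close> is determined by its inner products with \<open>H\<close>. The right-hand side does not
  involve \<open>M\<close>, which gives uniqueness, and it telescopes, which gives the cocycle identity.\<close>

context inner_product_space
begin

lemma add_closed: "u \<in> car V \<Longrightarrow> v \<in> car V \<Longrightarrow> u + v \<in> car V"
proof -
  interpret vector_space "scl V" by (rule vector_space)
  show "u \<in> car V \<Longrightarrow> v \<in> car V \<Longrightarrow> u + v \<in> car V" by (rule subspace_add[OF subspace])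
qed

lemma diff_closed: "u \<in> car V \<Longrightarrow> v \<in> car V \<Longrightarrow> u - v \<in> car V"
proof -
  interpret vector_space "scl V" by (rule vector_space)
  show "u \<in> car V \<Longrightarrow> v \<in> car V \<Longrightarrow> u - v \<in> car V" by (rule subspace_diff[OF subspace])
qed

text \<open>Conjugate symmetry moves the sum into the first slot, and \<open>conj\<close> is
  additive.\<close>

lemma ip_add_right:
  assumes "u \<in> car V" "v \<in> car V" "w \<in> car V"
  shows "ip V u (v + w) = ip V u v + ip V u w"
  using assms by (simp add: ip_conj[of _ u] add_closed ip_add_left conj_add)

text \<open>Testing against \<open>u - v\<close>, which itself lies in \<open>car V\<close>, forces
  its inner product with itself to vanish.\<close>

lemma eq_if_ip_eq:
  assumes "u \<in> car V" "v \<in> car V" and eq: "\<And>w. w \<in> car V \<Longrightarrow> ip V u w = ip V v w"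
  shows "u = v"
proof -
  have d: "u - v \<in> car V" using assms by (simp add: diff_closed)
  \<comment> \<open>Splitting \<open>u\<close> as \<open>(u - v) + v\<close> lets additivity in the
    first slot do the work of a subtraction rule.\<close>
  have "ip V u (u - v) = ip V (u - v) (u - v) + ip V v (u - v)"
    using ip_add_left[OF d assms(2) d] by simp
  then have "ip V (u - v) (u - v) = 0" using eq[OF d] by simp
  then have "u - v = 0" by (rule ip_definite[OF d])
  then show ?thesis by simp
qed

end

text \<open>Adjointability supplies some adjoint, so the one chosen by \<open>SOME\<close> in
  \<open>adj\<close> satisfies the defining relation.\<close>

lemma ip_adj:
  assumes "adjointable V W T" "v \<in> car V" "w \<in> car W"
  shows "ip W (T v) w = ip V v (adj V W T w)"
proof -
  have "is_adjoint V W T (adj V W T)"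
    using assms(1) unfolding adjointable_def adj_def by (rule someI_ex)
  then show ?thesis using assms by (simp add: is_adjoint_def)
qed

lemma difference_family_closed:
  assumes "difference_family X Y H M" "x \<in> X" "y \<in> X" "t \<in> car Y"
  shows "M x y t \<in> car H"
  using assms by (auto simp: difference_family_def bounded_ops_def linear_map_def)

lemma ip_difference_family:
  assumes "difference_family X Y H M" "x \<in> X" "y \<in> X" "t \<in> car Y" "f \<in> car H"
  shows "ip H (M x y t) f = ip Y t (f y - f x)"
  using assms ip_adj[of Y H "M x y" t f] by (simp add: difference_family_def)

text \<open>Both values have the same inner products with \<open>H\<close>. Agreement is claimed
  only for indices in \<open>X\<close> and vectors in \<open>car Y\<close>, since outside these sets
  the total functions \<open>M\<close> and \<open>M'\<close> are unconstrained.\<close>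

lemma difference_family_unique:
  assumes "inner_product_space H" "difference_family X Y H M" "difference_family X Y H M'"
    and "x \<in> X" "y \<in> X" "t \<in> car Y"
  shows "M' x y t = M x y t"
  using assms
  by (intro inner_product_space.eq_if_ip_eq[OF assms(1)])
    (simp_all add: difference_family_closed ip_difference_family)

lemma difference_family_cocycle:
  assumes "inner_product_space Y" "hilbert_function_space X Y H" "difference_family X Y H M"
    and x: "x1 \<in> X" "x2 \<in> X" "x3 \<in> X" and t: "t \<in> car Y"
  shows "M x1 x2 t + M x2 x3 t = M x1 x3 t"
proof -
  interpret Y: inner_product_space Y by fact
  interpret H: hilbert_space H using assms(2) by (simp add: hilbert_function_space_def)
  note closed = difference_family_closed[OF assms(3)]
  show ?thesis
  proof (rule H.eq_if_ip_eq)
    fix f assume f: "f \<in> car H"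
    \<comment> \<open>Additivity in the second slot is available only on \<open>car Y\<close>, so
      the increments of \<open>f\<close> must be known to lie there.\<close>
    then have fx: "f x \<in> car Y" if "x \<in> X" for x
      using assms(2) that by (auto simp: hilbert_function_space_def function_space_def)
    have "ip H (M x1 x2 t + M x2 x3 t) f = ip Y t (f x2 - f x1) + ip Y t (f x3 - f x2)"
      using f x t by (simp add: H.ip_add_left closed ip_difference_family[OF assms(3)])
    also have "\<dots> = ip Y t ((f x2 - f x1) + (f x3 - f x2))"
      using x t by (intro Y.ip_add_right[symmetric] Y.diff_closed fx)
    \<comment> \<open>The terms \<open>f x2\<close> cancel, leaving the increment from
      \<open>x1\<close> to \<open>x3\<close>.\<close>
    also have "\<dots> = ip H (M x1 x3 t) f"
      using f x t by (simp add: ip_difference_family[OF assms(3)])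
    finally show "ip H (M x1 x2 t + M x2 x3 t) f = ip H (M x1 x3 t) f" .
  qed (use x t in \<open>simp_all add: H.add_closed closed\<close>)
qed

theorem theorem2p3:
  fixes X :: "'x set"
    and Y :: "('k :: real_or_complex, 'y :: ab_group_add) ip_space"
    and H :: "('k, 'x \<Rightarrow> 'y) ip_space"
  assumes "inner_product_space Y"
    and "relative_rkhs X Y H"
  shows "\<exists>M. difference_family X Y H M \<and>
           (\<forall>M'. difference_family X Y H M' \<longrightarrow>
              (\<forall>x\<in>X. \<forall>y\<in>X. \<forall>t\<in>car Y. M' x y t = M x y t)) \<and>
           (\<forall>x1\<in>X. \<forall>x2\<in>X. \<forall>x3\<in>X. \<forall>t\<in>car Y. M x1 x2 t + M x2 x3 t = M x1 x3 t)"
proof -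
  obtain M where M: "difference_family X Y H M"
    using assms(2) by (auto simp: relative_rkhs_def)
  have H: "hilbert_function_space X Y H"
    using assms(2) by (auto simp: relative_rkhs_def rkhs_def rkhs_with_kernel_def)
  then have "inner_product_space H"
    by (simp add: hilbert_function_space_def hilbert_space_def)
  then show ?thesis
    using M difference_family_unique[OF _ M] difference_family_cocycle[OF assms(1) H M] by blast
qed

end
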